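(* Let $Y\in\mathbb{K}^{n\times n}$ be a matrix such that $\sigma(Y)=Y^*$. Assume that $\sigma(D)$ is positive semi-definite for the matrix $D$ of singular values of $Y$. Then there exists a polar decomposition $Y=S\Omega$ such that $\sigma(\Omega)=\Omega^*$ and $\sigma(S)=\Omega^*S\Omega$.
   Context: Let $\mathbb{K}$ be one of $\mathbb{R}$, $\mathbb{C}$, $\mathbb{H}$ (quaternions). For $A\in\mathbb{K}^{n\times n}$, $A^*$ is its conjugate transpose; $A$ is called orthogonal if $A\in O(n,\mathbb{K})=\{A\in\mathbb{K}^{n\times n}:AA^*=I\}$ (so orthogonal, unitary or symplectic according to $\mathbb{K}$). $\sigma\colon\mathbb{K}^{n\times n}\to\mathbb{K}^{n\times n}$ is an involutive automorphism of unital (real) algebras satisfying $\sigma(Y^* )=\sigma(Y)^*$ for all $Y$. For $Y\in\mathbb{K}^{n\times n}$, the matrix $YY^*$ is Hermitian positive-semidefinite with eigenvalues $0,t_1^2,\dots,t_k^2$ of multiplicities $n_0,n_1,\dots,n_k$, $0<t_1<\dots<t_k$, $n_0+\cdots+n_k=n$; the matrix of singular values of $Y$ is the real diagonal matrix $D$ with diagonal blocks $0_{n_0},t_1I_{n_1},\dots,t_kI_{n_k}$. A (left) polar decomposition of $Y$ is a factorization $Y=S\Omega$ with $\Omega\in O(n,\mathbb{K})$ and $S$ Hermitian positive-semidefinite (then necessarily $S=(YY^* )^{1/2}$). *)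

theory Defs
  imports "HOL-Analysis.Analysis"
begin

section \<open>Quaternions\<close>

datatype quat = Quat (qRe: real) (qI: real) (qJ: real) (qK: real)

instantiation quat :: ab_group_add
begin

definition "0 = Quat 0 0 0 0"
definition "x + y = Quat (qRe x + qRe y) (qI x + qI y) (qJ x + qJ y) (qK x + qK y)"
definition "- x = Quat (- qRe x) (- qI x) (- qJ x) (- qK x)"
definition "x - y = Quat (qRe x - qRe y) (qI x - qI y) (qJ x - qJ y) (qK x - qK y)"

instance
  by standard
    (simp_all add: zero_quat_def plus_quat_def uminus_quat_def minus_quat_def)

end

instantiation quat :: real_algebra_1
begin

definition "1 = Quat 1 0 0 0"
definition "x * y =
  Quat (qRe x * qRe y - qI x * qI y - qJ x * qJ y - qK x * qK y)
       (qRe x * qI y + qI x * qRe y + qJ x * qK y - qK x * qJ y)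
       (qRe x * qJ y - qI x * qK y + qJ x * qRe y + qK x * qI y)
       (qRe x * qK y + qI x * qJ y - qJ x * qI y + qK x * qRe y)"
definition "r *\<^sub>R x = Quat (r * qRe x) (r * qI x) (r * qJ x) (r * qK x)"

instance
  by standard
    (simp_all add: zero_quat_def plus_quat_def one_quat_def times_quat_def scaleR_quat_def
      algebra_simps)

end

section \<open>Conjugation on the scalars\<close>

class conj_algebra = real_algebra_1 +
  fixes kconj :: "'a \<Rightarrow> 'a"
  assumes kconj_add: "kconj (x + y) = kconj x + kconj y"
    and kconj_scaleR: "kconj (r *\<^sub>R x) = r *\<^sub>R kconj x"
    and kconj_mult: "kconj (x * y) = kconj y * kconj x"
    and kconj_kconj: "kconj (kconj x) = x"

instantiation real :: conj_algebra
begin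
definition "kconj (x :: real) = x"
instance by standard (simp_all add: kconj_real_def)
end

instantiation complex :: conj_algebra
begin
definition "kconj = cnj"
instance by standard (simp_all add: kconj_complex_def)
end

instantiation quat :: conj_algebra
begin
definition "kconj x = Quat (qRe x) (- qI x) (- qJ x) (- qK x)"
instance
  by standard (simp_all add: kconj_quat_def plus_quat_def times_quat_def scaleR_quat_def)
end

section \<open>Matrices\<close>

type_synonym ('k, 'n) sq_matrix = "(('k, 'n) vec, 'n) vec"

definition adj :: "('k::conj_algebra)^'n^'m \<Rightarrow> 'k^'m^'n" where
  "adj A = (\<chi> i j. kconj (A $ j $ i))"

definition orthogonal_group :: "(('k::conj_algebra)^'n^'n) set" where
  "orthogonal_group = {A. A ** adj A = mat 1}"

definition hermitian :: "('k::conj_algebra)^'n^'n \<Rightarrow> bool" where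
  "hermitian A \<longleftrightarrow> adj A = A"

definition pos_semidef :: "('k::conj_algebra)^'n^'n \<Rightarrow> bool" where
  "pos_semidef A \<longleftrightarrow> hermitian A \<and>
     (\<forall>x. \<exists>r::real. 0 \<le> r \<and> (\<Sum>i\<in>UNIV. kconj (x $ i) * (A *v x) $ i) = of_real r)"

definition polar_decomposition ::
    "('k::conj_algebra)^'n^'n \<Rightarrow> 'k^'n^'n \<Rightarrow> 'k^'n^'n \<Rightarrow> bool" where
  "polar_decomposition Y S \<Omega> \<longleftrightarrow>
     Y = S ** \<Omega> \<and> \<Omega> \<in> orthogonal_group \<and> pos_semidef S"

text \<open>
  Over the quaternions, \<open>A *v x\<close> commutes with scalar multiplication of \<open>x\<close> from the right, so
  the column vectors form a right vector space.  The dimension theory of the library needs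
  commutative scalars; hence the explicit notion of dimension below.
\<close>

definition rscale :: "('k::conj_algebra)^'n \<Rightarrow> 'k \<Rightarrow> 'k^'n" where
  "rscale x c = (\<chi> i. x $ i * c)"

definition right_basis :: "(('k::conj_algebra)^'n) set \<Rightarrow> ('k^'n) set \<Rightarrow> bool" where
  "right_basis B V \<longleftrightarrow> finite B \<and>
     V = {\<Sum>b\<in>B. rscale b (c b) | c. True} \<and>
     (\<forall>c. (\<Sum>b\<in>B. rscale b (c b)) = 0 \<longrightarrow> (\<forall>b\<in>B. c b = 0))"

definition has_right_dim :: "(('k::conj_algebra)^'n) set \<Rightarrow> nat \<Rightarrow> bool" where
  "has_right_dim V m \<longleftrightarrow> (\<exists>B. right_basis B V \<and> card B = m)"

text \<open>Only real eigenvalues occur below; these commute with all scalars.\<close>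

definition eigenspace :: "('k::conj_algebra)^'n^'n \<Rightarrow> real \<Rightarrow> ('k^'n) set" where
  "eigenspace A \<mu> = {x. A *v x = \<mu> *\<^sub>R x}"

text \<open>
  The diagonal of \<open>D\<close> is weakly increasing, so equal entries form consecutive blocks; the block
  belonging to \<open>t\<close> has the multiplicity of \<open>t\<^sup>2\<close> as an eigenvalue of \<open>Y Y\<^sup>*\<close> (for Hermitian
  matrices, the dimension of the eigenspace) as its size.  For a \<open>t\<close> that is not a singular value
  the eigenspace is zero and both sides of the last condition are \<open>0\<close>.
\<close>

definition singular_value_matrix ::
    "('k::conj_algebra, 'n::{finite,linorder}) sq_matrix \<Rightarrow> ('k, 'n) sq_matrix \<Rightarrow> bool" where
  "singular_value_matrix Y D \<longleftrightarrow>
     (\<exists>d :: 'n \<Rightarrow> real.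
        D = (\<chi> i j. if i = j then of_real (d i) else 0) \<and>
        mono d \<and> (\<forall>i. 0 \<le> d i) \<and>
        (\<forall>t\<ge>0. has_right_dim (eigenspace (Y ** adj Y) (t\<^sup>2)) (card {i. d i = t})))"

text \<open>Linearity is over the reals, also for complex and quaternionic matrices.\<close>

definition algebra_automorphism ::
    "(('k::conj_algebra)^'n^'n \<Rightarrow> 'k^'n^'n) \<Rightarrow> bool" where
  "algebra_automorphism \<sigma> \<longleftrightarrow> linear \<sigma> \<and> bij \<sigma> \<and>
     (\<forall>A B. \<sigma> (A ** B) = \<sigma> A ** \<sigma> B) \<and> \<sigma> (mat 1) = mat 1"

definition involutive_star_automorphism ::
    "(('k::conj_algebra)^'n^'n \<Rightarrow> 'k^'n^'n) \<Rightarrow> bool" where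
  "involutive_star_automorphism \<sigma> \<longleftrightarrow> algebra_automorphism \<sigma> \<and>
     (\<forall>A. \<sigma> (\<sigma> A) = A) \<and> (\<forall>A. \<sigma> (adj A) = adj (\<sigma> A))"

end

theory Submission imports Defs begin

text \<open>
  If \<open>Y\<close> is invertible, \<open>\<Omega> = (Y Y\<^sup>*)\<^sup>-\<^sup>1\<^sup>/\<^sup>2 Y\<close> is the only possible factor; the inverse root is a real
  polynomial \<open>q\<close> in \<open>Y Y\<^sup>*\<close>, hence \<open>\<sigma>(\<Omega>) = q(Y\<^sup>* Y) Y\<^sup>* = Y\<^sup>* q(Y Y\<^sup>*) = \<Omega>\<^sup>*\<close>.  A general \<open>Y\<close> is the limit of
  the matrices \<open>Y + t I\<close>, which satisfy \<open>\<sigma>(Y + t I) = (Y + t I)\<^sup>*\<close> and are invertible for all small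
  \<open>t > 0\<close>; the orthogonal group is compact, so their factors accumulate at a factor \<open>\<Omega>\<close> of \<open>Y\<close> with
  \<open>\<sigma>(\<Omega>) = \<Omega>\<^sup>*\<close>.  Finally \<open>\<sigma>(S) = \<Omega>\<^sup>* S \<Omega>\<close> follows by applying \<open>\<sigma>\<close> to \<open>S = Y \<Omega>\<^sup>*\<close>.
\<close>

section \<open>Euclidean scalars\<close>

instantiation quat :: real_inner
begin

definition inner_quat :: "quat \<Rightarrow> quat \<Rightarrow> real" where
  "inner_quat x y = qRe x * qRe y + qI x * qI y + qJ x * qJ y + qK x * qK y"
definition norm_quat :: "quat \<Rightarrow> real" where
  "norm_quat x = sqrt (inner x x)"
definition sgn_quat :: "quat \<Rightarrow> quat" where
  "sgn_quat x = x /\<^sub>R norm x"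
definition dist_quat :: "quat \<Rightarrow> quat \<Rightarrow> real" where
  "dist_quat x y = norm (x - y)"
definition uniformity_quat :: "(quat \<times> quat) filter" where
  "uniformity_quat = (INF e\<in>{0 <..}. principal {(x, y). dist x y < e})"
definition open_quat :: "quat set \<Rightarrow> bool" where
  "open_quat U \<longleftrightarrow> (\<forall>x\<in>U. eventually (\<lambda>(x', y). x' = x \<longrightarrow> y \<in> U) uniformity)"

instance
proof
  fix x y z :: quat and r :: real
  show "inner x y = inner y x"
    by (simp add: inner_quat_def mult.commute)
  show "inner (x + y) z = inner x z + inner y z"
    by (simp add: inner_quat_def plus_quat_def algebra_simps)
  show "inner (r *\<^sub>R x) y = r * inner x y"
    by (simp add: inner_quat_def scaleR_quat_def algebra_simps)
  show "0 \<le> inner x x"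
    by (simp add: inner_quat_def)
  show "inner x x = 0 \<longleftrightarrow> x = 0"
    by (cases x) (simp add: inner_quat_def zero_quat_def add_nonneg_eq_0_iff)
qed (simp_all add: norm_quat_def sgn_quat_def dist_quat_def uniformity_quat_def open_quat_def)

end

instantiation quat :: euclidean_space
begin

definition Basis_quat :: "quat set" where
  "Basis_quat = {Quat 1 0 0 0, Quat 0 1 0 0, Quat 0 0 1 0, Quat 0 0 0 1}"

instance
proof
  fix x :: quat
  show "(\<forall>u\<in>Basis. inner x u = 0) \<longleftrightarrow> x = 0"
    by (cases x) (auto simp: Basis_quat_def inner_quat_def zero_quat_def)
qed (auto simp: Basis_quat_def inner_quat_def)

end

text \<open>The common ground of the three scalar algebras: left multiplication by \<open>x\<close>
  has left multiplication by \<open>kconj x\<close> as its real adjoint. Vectors over each of them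
  can thus be handled as real Euclidean vectors, with compactness and real dimension at
  hand.\<close>

class euclidean_conj_algebra = conj_algebra + euclidean_space +
  assumes inner_mult_left_kconj: "inner (x * y) z = inner y (kconj x * z)"
    and kconj_mult_self_scaleR: "kconj x * x = inner x x *\<^sub>R 1"

instance real :: euclidean_conj_algebra
  by standard (simp_all add: kconj_real_def)

instance complex :: euclidean_conj_algebra
  by standard (simp_all add: kconj_complex_def inner_complex_def complex_eq_iff algebra_simps)

instance quat :: euclidean_conj_algebra
  by standard (simp_all add: kconj_quat_def inner_quat_def times_quat_def of_real_def
      scaleR_quat_def one_quat_def algebra_simps)

lemma kconj_mult_self: "kconj x * x = of_real ((x :: 'k::euclidean_conj_algebra) \<bullet> x)"
  by (simp add: kconj_mult_self_scaleR of_real_def)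

lemma kconj_zero [simp]: "kconj (0 :: 'k::conj_algebra) = 0"
  using kconj_scaleR[of 0 "0 :: 'k"] by simp

lemma kconj_one [simp]: "kconj (1 :: 'k::conj_algebra) = 1"
  by (metis kconj_kconj kconj_mult mult.right_neutral mult.left_neutral)

lemma kconj_sum: "kconj (sum f A) = (\<Sum>a\<in>A. kconj (f a :: 'k::conj_algebra))"
  by (induction A rule: infinite_finite_induct) (simp_all add: kconj_add)

text \<open>The two bracketings of \<open>x * kconj x * x\<close> are real multiples of
  \<open>x\<close>, with factors \<open>kconj x \<bullet> kconj x\<close> and
  \<open>x \<bullet> x\<close>; a nonzero \<open>x\<close> cancels.\<close>

lemma inner_kconj_self: "kconj x \<bullet> kconj x = (x :: 'k::euclidean_conj_algebra) \<bullet> x"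
proof (cases "x = 0")
  case False
  have "(x * kconj x) * x = x * (kconj x * x)"
    by (simp add: mult.assoc)
  then have "(kconj x \<bullet> kconj x) *\<^sub>R x = (x \<bullet> x) *\<^sub>R x"
    using kconj_mult_self[of x] kconj_mult_self[of "kconj x"]
    by (simp add: kconj_kconj of_real_def)
  with False show ?thesis
    by (simp del: scaleR_right_imp_eq)
qed simp

section \<open>Matrix algebra over the reals\<close>

lemma adj_adj [simp]: "adj (adj A) = A"
  by (simp add: adj_def vec_eq_iff kconj_kconj)

lemma adj_mult: "adj (A ** B) = adj B ** adj A"
  by (simp add: adj_def vec_eq_iff matrix_matrix_mult_def kconj_sum kconj_mult)

lemma adj_mat_1 [simp]: "adj (mat 1) = mat 1"
  by (simp add: adj_def vec_eq_iff mat_def)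

lemma linear_adj: "linear adj"
  by (simp add: linear_iff adj_def vec_eq_iff kconj_add kconj_scaleR)

lemma scaleR_matrix_mult_left:
  "(r *\<^sub>R A) ** B = r *\<^sub>R (A ** (B :: 'k::real_algebra_1^'n^'m))"
  by (simp add: vec_eq_iff matrix_matrix_mult_def scaleR_sum_right)

lemma scaleR_matrix_mult_right:
  "A ** (r *\<^sub>R B) = r *\<^sub>R (A ** (B :: 'k::real_algebra_1^'n^'m))"
  by (simp add: vec_eq_iff matrix_matrix_mult_def scaleR_sum_right)

lemma scaleR_matrix_vector_mult:
  "(r *\<^sub>R A) *v x = r *\<^sub>R (A *v (x :: 'k::real_algebra_1^'n))"
  by (simp add: vec_eq_iff matrix_vector_mult_def scaleR_sum_right)

lemma matrix_vector_mult_scaleR_right: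
  "A *v (r *\<^sub>R x) = r *\<^sub>R (A *v (x :: 'k::real_algebra_1^'n))"
  by (simp add: vec_eq_iff matrix_vector_mult_def scaleR_sum_right)

lemma matrix_add_rdistrib: "(A + B) ** C = A ** C + B ** (C :: 'k::semiring_1^'n^'m)"
  by (simp add: vec_eq_iff matrix_matrix_mult_def distrib_right sum.distrib)

lemma bilinear_matrix_mult: "bilinear ((**) :: 'k::real_algebra_1^'n^'m \<Rightarrow> 'k^'p^'n \<Rightarrow> 'k^'p^'m)"
  unfolding bilinear_def linear_iff
  by (simp add: matrix_add_ldistrib matrix_add_rdistrib scaleR_matrix_mult_left
      scaleR_matrix_mult_right)

lemma matrix_mult_sum_left:
  "(\<Sum>i\<in>I. f i) ** B = (\<Sum>i\<in>I. f i ** (B :: 'k::real_algebra_1^'n^'m))"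
  by (rule linear_sum[of "\<lambda>A. A ** B"]) (use bilinear_matrix_mult in \<open>auto simp: bilinear_def\<close>)

lemma matrix_mult_sum_right:
  "B ** (\<Sum>i\<in>I. f i) = (\<Sum>i\<in>I. B ** (f i :: 'k::real_algebra_1^'n^'m))"
  by (rule linear_sum[of "(**) B"]) (use bilinear_matrix_mult in \<open>auto simp: bilinear_def\<close>)

lemma matrix_vector_mult_sum_left: "(\<Sum>i\<in>I. f i) *v x = (\<Sum>i\<in>I. f i *v (x :: 'k::ring_1^'n))"
  by (induction I rule: infinite_finite_induct) (simp_all add: matrix_vector_mult_add_rdistrib)

lemma bounded_bilinear_matrix_mult:
  "bounded_bilinear ((**) :: 'k::euclidean_conj_algebra^'n^'m \<Rightarrow> 'k^'p^'n \<Rightarrow> 'k^'p^'m)"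
  using bilinear_matrix_mult bilinear_conv_bounded_bilinear by blast

text \<open>Entrywise this is \<open>inner_mult_left_kconj\<close>. It turns a Hermitian matrix into
  a symmetric operator on a real Euclidean space.\<close>

lemma inner_matrix_vector_adj:
  fixes A :: "'k::euclidean_conj_algebra^'n^'m"
  shows "(A *v x) \<bullet> y = x \<bullet> (adj A *v y)"
proof -
  have "(A *v x) \<bullet> y = (\<Sum>i\<in>UNIV. \<Sum>j\<in>UNIV. x $ j \<bullet> (kconj (A $ i $ j) * y $ i))"
    by (simp add: inner_vec_def matrix_vector_mult_def inner_sum_left inner_mult_left_kconj)
  also have "\<dots> = x \<bullet> (adj A *v y)"
    by (subst sum.swap) (simp add: inner_vec_def matrix_vector_mult_def inner_sum_right adj_def)
  finally show ?thesis .
qed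

section \<open>Real polynomials in a matrix\<close>

primrec mpow :: "'k::real_algebra_1^'n^'n \<Rightarrow> nat \<Rightarrow> 'k^'n^'n" where
  "mpow A 0 = mat 1"
| "mpow A (Suc m) = A ** mpow A m"

text \<open>The coefficients are real because \<sigma> is only real-linear; real scalars are also
  fixed by conjugation, so \<open>mpoly p\<close> commutes with both \<sigma> and
  \<open>adj\<close>.\<close>

definition mpoly :: "real poly \<Rightarrow> 'k::real_algebra_1^'n^'n \<Rightarrow> 'k^'n^'n" where
  "mpoly p A = (\<Sum>i\<le>degree p. coeff p i *\<^sub>R mpow A i)"

lemma mpow_intertwine:
  assumes "B ** A = A' ** B"
  shows "B ** mpow A m = mpow A' m ** B"
proof (induction m)
  case (Suc m)
  have "B ** mpow A (Suc m) = A' ** (B ** mpow A m)"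
    by (simp add: matrix_mul_assoc assms)
  then show ?case
    by (simp add: Suc matrix_mul_assoc)
qed simp

text \<open>\<open>B\<close> moves past the powers one factor at a time. Besides commutation
  (\<open>B = A = A'\<close>), the case of interest is \<open>B = adj Y\<close>,
  \<open>A = Y ** adj Y\<close>, \<open>A' = adj Y ** Y\<close>.\<close>

lemma mpoly_intertwine:
  assumes "B ** A = A' ** B"
  shows "B ** mpoly p A = mpoly p A' ** B"
  by (simp add: mpoly_def matrix_mult_sum_left matrix_mult_sum_right scaleR_matrix_mult_left
      scaleR_matrix_mult_right mpow_intertwine[OF assms])

lemma adj_mpow: "adj (mpow A m) = mpow (adj A) m"
  by (induction m) (simp_all add: adj_mult mpow_intertwine[of "adj A" "adj A" "adj A"])

lemma adj_mpoly: "adj (mpoly p A) = mpoly p (adj A)"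
  by (simp add: mpoly_def linear_sum[OF linear_adj] linear_scale[OF linear_adj] adj_mpow)

lemma algebra_automorphism_mpoly:
  assumes "algebra_automorphism \<sigma>"
  shows "\<sigma> (mpoly p A) = mpoly p (\<sigma> A)"
proof -
  have "linear \<sigma>"
    using assms by (simp add: algebra_automorphism_def)
  moreover have "\<sigma> (mpow A m) = mpow (\<sigma> A) m" for m
    using assms by (induction m) (simp_all add: algebra_automorphism_def)
  ultimately show ?thesis
    by (simp add: mpoly_def linear_sum linear_scale)
qed

lemma mpoly_eigenvector:
  fixes A :: "'k::real_algebra_1^'n^'n"
  assumes "A *v v = \<mu> *\<^sub>R v"
  shows "mpoly p A *v v = poly p \<mu> *\<^sub>R v"
proof -
  have "mpow A m *v v = \<mu> ^ m *\<^sub>R v" for m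
    by (induction m)
      (simp_all add: matrix_vector_mul_assoc[symmetric] matrix_vector_mult_scaleR_right assms
        mult.commute)
  then show ?thesis
    by (simp add: mpoly_def matrix_vector_mult_sum_left scaleR_matrix_vector_mult poly_altdef
        scaleR_sum_left)
qed

text \<open>Newton interpolation: a new node is served by adding a multiple of a polynomial that
  vanishes at the old ones. On a finite spectrum this replaces a functional calculus.\<close>

lemma poly_interpolation:
  fixes f :: "'a::field \<Rightarrow> 'a"
  assumes "finite L"
  shows "\<exists>p. \<forall>x\<in>L. poly p x = f x"
  using assms
proof induction
  case (insert a L)
  then obtain p where p: "\<forall>x\<in>L. poly p x = f x"
    by blast
  define q where "q = (\<Prod>m\<in>L. [:- m, 1:])"
  have "poly q a \<noteq> 0" "\<forall>x\<in>L. poly q x = 0"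
    using insert by (auto simp: q_def poly_prod)
  with p have "\<forall>x\<in>insert a L. poly (p + smult ((f a - poly p a) / poly q a) q) x = f x"
    by simp
  then show ?case
    by blast
qed simp

section \<open>Eigenvalues\<close>

definition eigenvals :: "'k::real_algebra_1^'n^'n \<Rightarrow> real set" where
  "eigenvals A = {\<mu>. \<exists>v. v \<noteq> 0 \<and> A *v v = \<mu> *\<^sub>R v}"

text \<open>Eigenvectors for distinct real eigenvalues are linearly independent over the reals, so
  the real dimension bounds their number.\<close>

lemma finite_eigenvals:
  fixes A :: "'k::euclidean_conj_algebra^'n^'n"
  shows "finite (eigenvals A)"
proof (rule ccontr)
  assume "infinite (eigenvals A)"
  then obtain F where F: "finite F" "card F = Suc (DIM('k^'n))" "F \<subseteq> eigenvals A"
    using infinite_arbitrarily_large by blast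
  from F(3) have "\<forall>\<mu>\<in>F. \<exists>v. v \<noteq> 0 \<and> A *v v = \<mu> *\<^sub>R v"
    by (auto simp: eigenvals_def)
  then obtain v where v: "\<And>\<mu>. \<mu> \<in> F \<Longrightarrow> v \<mu> \<noteq> 0" "\<And>\<mu>. \<mu> \<in> F \<Longrightarrow> A *v v \<mu> = \<mu> *\<^sub>R v \<mu>"
    using bchoice[of F "\<lambda>\<mu> v. v \<noteq> 0 \<and> A *v v = \<mu> *\<^sub>R v"] by blast
  have inj: "inj_on v F"
  proof (rule inj_onI)
    fix x y assume xy: "x \<in> F" "y \<in> F" and eq: "v x = v y"
    have "x *\<^sub>R v x = y *\<^sub>R v x"
      using trans[OF v(2)[OF xy(1), symmetric] v(2)[OF xy(2), folded eq]] .
    with v(1)[OF xy(1)] show "x = y"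
      by (simp only: scaleR_cancel_right) simp
  qed
  have "independent (v ` F)"
  proof (rule independent_if_scalars_zero)
    show "finite (v ` F)"
      using F by simp
    fix c w assume c: "(\<Sum>x\<in>v ` F. c x *\<^sub>R x) = 0" and "w \<in> v ` F"
    then obtain \<mu> where \<mu>: "\<mu> \<in> F" "w = v \<mu>"
      by blast
    \<comment> \<open>\<open>mpoly p A\<close> multiplies \<open>v x\<close> by
      \<open>poly p x\<close>, so this indicator polynomial extracts the term at
      \<open>\<mu>\<close> from the linear relation.\<close>
    obtain p where p: "\<forall>x\<in>F. poly p x = (if x = \<mu> then 1 else 0)"
      using poly_interpolation[OF F(1), of "\<lambda>x. if x = \<mu> then 1 else 0"] by blast
    have "0 = mpoly p A *v (\<Sum>x\<in>F. c (v x) *\<^sub>R v x)"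
      using c by (simp add: sum.reindex[OF inj])
    also have "\<dots> = (\<Sum>x\<in>F. c (v x) *\<^sub>R (mpoly p A *v v x))"
      by (simp add: linear_sum[OF matrix_vector_mul_linear] matrix_vector_mult_scaleR_right)
    also have "\<dots> = (\<Sum>x\<in>F. if x = \<mu> then c (v x) *\<^sub>R v x else 0)"
      using p by (intro sum.cong) (auto simp: mpoly_eigenvector[OF v(2)])
    also have "\<dots> = c w *\<^sub>R w"
      using \<mu> F(1) by simp
    finally show "c w = 0"
      using v(1)[OF \<mu>(1)] \<mu>(2) by simp
  qed
  then have "card (v ` F) \<le> DIM('k^'n)"
    by (rule independent_bound[THEN conjunct2])
  then show False
    using F(2) card_image[OF inj] by simp
qed

section \<open>Spectral theorem for symmetric operators on a real Euclidean space\<close>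

lemma nonneg_quadratic_imp_linear_coeff_zero:
  fixes b c :: real
  assumes "\<And>s. 0 \<le> 2 * s * b + s\<^sup>2 * c"
  shows "b = 0"
proof (rule ccontr)
  assume "b \<noteq> 0"
  \<comment> \<open>At \<open>s = - b / d\<close> the quadratic equals
    \<open>(b / d)\<^sup>2 * (c - 2 * d)\<close>, which is negative as soon as \<open>d > 0\<close>
    and \<open>c < 2 * d\<close>.\<close>
  define d where "d = \<bar>c\<bar> + 1"
  have d: "d > 0" "c < 2 * d"
    by (auto simp: d_def)
  have "2 * (- b / d) * b + (- b / d)\<^sup>2 * c = (b / d)\<^sup>2 * (c - 2 * d)"
    using d(1) by (simp add: field_simps power2_eq_square)
  also have "\<dots> < 0"
    using \<open>b \<noteq> 0\<close> d by (intro mult_pos_neg) auto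
  finally show False
    using assms[of "- b / d"] by linarith
qed

text \<open>The Rayleigh quotient attains its maximum on the compact unit sphere of
  \<open>W\<close>, and the first-order condition at a maximum point is the eigenvector
  equation.\<close>

lemma symmetric_eigenvector_in_invariant_subspace:
  fixes f :: "'a::euclidean_space \<Rightarrow> 'a"
  assumes lin: "linear f" and sym: "\<And>x y. f x \<bullet> y = x \<bullet> f y"
    and W: "subspace W" "\<And>x. x \<in> W \<Longrightarrow> f x \<in> W" and w: "w \<in> W" "w \<noteq> 0"
  shows "\<exists>v\<in>W. \<exists>\<mu>. v \<noteq> 0 \<and> f v = \<mu> *\<^sub>R v"
proof -
  have "compact (sphere 0 1 \<inter> W)"
    using closed_subspace[OF W(1)] by (simp add: compact_Int_closed)
  moreover have "w /\<^sub>R norm w \<in> sphere 0 1 \<inter> W"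
    using w W(1) by (simp add: subspace_scale)
  moreover have "continuous_on (sphere 0 1 \<inter> W) (\<lambda>x. f x \<bullet> x)"
    using lin by (intro continuous_intros linear_continuous_on linear_conv_bounded_linear[THEN iffD1])
  ultimately have "\<exists>v\<in>sphere 0 1 \<inter> W. \<forall>x\<in>sphere 0 1 \<inter> W. f x \<bullet> x \<le> f v \<bullet> v"
    by (intro continuous_attains_sup) blast+
  then obtain v where v: "v \<in> W" "norm v = 1"
    and max: "\<And>x. x \<in> W \<Longrightarrow> norm x = 1 \<Longrightarrow> f x \<bullet> x \<le> f v \<bullet> v"
    by auto
  define \<mu> where "\<mu> = f v \<bullet> v"
  \<comment> \<open>By homogeneity \<open>q\<close> is nonnegative on all of \<open>W\<close>, and
    it vanishes at \<open>v\<close>, which is therefore a minimum of \<open>q\<close> there.\<close>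
  define q where "q = (\<lambda>x. \<mu> * (x \<bullet> x) - f x \<bullet> x)"
  have q: "0 \<le> q x" if "x \<in> W" for x
  proof (cases "x = 0")
    case False
    have "f (x /\<^sub>R norm x) \<bullet> (x /\<^sub>R norm x) \<le> \<mu>"
      unfolding \<mu>_def using that False W(1) by (intro max) (simp_all add: subspace_scale)
    then have "(f x \<bullet> x) / (norm x)\<^sup>2 \<le> \<mu>"
      by (simp add: linear_scale[OF lin] power2_eq_square divide_inverse ac_simps)
    then show ?thesis
      using False by (simp add: q_def field_simps power2_norm_eq_inner)
  qed (simp add: q_def linear_0[OF lin])
  \<comment> \<open>The residual is the direction of variation: invariance keeps it in
    \<open>W\<close>, and the linear coefficient of \<open>q (v + s *\<^sub>R u)\<close> in
    \<open>s\<close> is \<open>2 * (u \<bullet> u)\<close>, forced to vanish at the minimum.\<close>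
  define u where "u = \<mu> *\<^sub>R v - f v"
  have u: "u \<in> W"
    unfolding u_def using v W by (simp add: subspace_diff subspace_scale)
  have "0 \<le> 2 * s * (u \<bullet> u) + s\<^sup>2 * q u" for s
  proof -
    have "f u \<bullet> v = f v \<bullet> u"
      by (subst sym) (rule inner_commute)
    then have "q (v + s *\<^sub>R u) = q v + 2 * s * (\<mu> * (v \<bullet> u) - f v \<bullet> u) + s\<^sup>2 * q u"
      unfolding q_def
      by (simp add: linear_add[OF lin] linear_scale[OF lin] inner_add_left inner_add_right
          power2_eq_square inner_commute[of u v]) (simp add: algebra_simps)
    also have "\<mu> * (v \<bullet> u) - f v \<bullet> u = u \<bullet> u"
      by (simp add: u_def inner_diff_left)
    finally have "q (v + s *\<^sub>R u) = q v + 2 * s * (u \<bullet> u) + s\<^sup>2 * q u" .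
    moreover have "q v = 0"
      using v(2) by (simp add: q_def \<mu>_def norm_eq_1)
    ultimately show ?thesis
      using q[of "v + s *\<^sub>R u"] v(1) u W(1) by (simp add: subspace_add subspace_scale)
  qed
  then have "u \<bullet> u = 0"
    by (rule nonneg_quadratic_imp_linear_coeff_zero)
  then have "f v = \<mu> *\<^sub>R v"
    by (simp add: u_def)
  with v show ?thesis
    by (intro bexI[of _ v]) auto
qed

text \<open>The orthogonal complement of all eigenvectors is invariant; were it nonzero, it would
  contain an eigenvector, orthogonal to itself.\<close>

lemma symmetric_eigenvectors_span:
  fixes f :: "'a::euclidean_space \<Rightarrow> 'a"
  assumes lin: "linear f" and sym: "\<And>x y. f x \<bullet> y = x \<bullet> f y"
  shows "span {v. \<exists>\<mu>. f v = \<mu> *\<^sub>R v} = UNIV"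
proof (rule ccontr)
  let ?E = "{v. \<exists>\<mu>. f v = \<mu> *\<^sub>R v}"
  define W where "W = {w. \<forall>v\<in>?E. w \<bullet> v = 0}"
  assume "span ?E \<noteq> UNIV"
  then obtain w where w: "w \<noteq> 0" "\<forall>x\<in>span ?E. w \<bullet> x = 0"
    using span_not_UNIV_orthogonal by blast
  have "subspace W"
    by (auto simp: W_def subspace_def inner_add_left)
  moreover have "f x \<in> W" if "x \<in> W" for x
    using that by (auto simp: W_def sym)
  moreover have "w \<in> W"
    using w(2) by (simp add: W_def span_base)
  ultimately obtain v where "v \<in> W" "v \<in> ?E" "v \<noteq> 0"
    using symmetric_eigenvector_in_invariant_subspace[OF lin sym, of W w] w(1) by blast
  then show False
    by (auto simp: W_def)
qed

text \<open>The eigenvectors of \<open>P\<close> span the space over the reals. Identities between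
  polynomials in \<open>P\<close> thereby reduce to identities between real numbers.\<close>

lemma hermitian_eqI:
  fixes P :: "'k::euclidean_conj_algebra^'n^'n"
  assumes "hermitian P" and "\<And>v \<mu>. v \<noteq> 0 \<Longrightarrow> P *v v = \<mu> *\<^sub>R v \<Longrightarrow> A *v v = B *v v"
  shows "A = B"
proof -
  have span: "span {v. \<exists>\<mu>. P *v v = \<mu> *\<^sub>R v} = UNIV"
    using assms(1) by (intro symmetric_eigenvectors_span) (simp_all add: inner_matrix_vector_adj hermitian_def)
  have "A *v v = B *v v" if "P *v v = \<mu> *\<^sub>R v" for v \<mu>
    using assms(2)[OF _ that] by (cases "v = 0") simp_all
  then have "A *v x = B *v x" for x
    by (intro linear_eq_on[of "(*v) A" "(*v) B" x "{v. \<exists>\<mu>. P *v v = \<mu> *\<^sub>R v}"])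
      (auto simp: span)
  then show ?thesis
    by (simp add: matrix_eq)
qed

section \<open>Polar decompositions\<close>

lemma gram_inner_nonneg:
  fixes T :: "'k::euclidean_conj_algebra^'n^'m"
  shows "0 \<le> x \<bullet> ((T ** adj T) *v x)"
  using inner_matrix_vector_adj[of T "adj T *v x" x]
  by (simp add: matrix_vector_mul_assoc inner_commute)

text \<open>With \<open>y = adj T *v x\<close> the scalar-valued form becomes the sum of the
  \<open>kconj (y $ j) * y $ j\<close>, each of them a nonnegative real.\<close>

lemma pos_semidef_gram:
  fixes T :: "'k::euclidean_conj_algebra^'n^'n"
  shows "pos_semidef (T ** adj T)"
  unfolding pos_semidef_def
proof (intro conjI allI)
  show "hermitian (T ** adj T)"
    by (simp add: hermitian_def adj_mult)
  fix x :: "'k^'n"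
  define y where "y = adj T *v x"
  have "(\<Sum>i\<in>UNIV. kconj (x $ i) * (T *v y) $ i)
      = (\<Sum>i\<in>UNIV. \<Sum>j\<in>UNIV. kconj (x $ i) * (T $ i $ j * y $ j))"
    by (simp add: matrix_vector_mult_def sum_distrib_left)
  also have "\<dots> = (\<Sum>j\<in>UNIV. kconj (y $ j) * y $ j)"
    by (subst sum.swap)
      (simp add: y_def matrix_vector_mult_def adj_def kconj_sum kconj_mult kconj_kconj
        sum_distrib_right mult.assoc)
  also have "\<dots> = of_real (y \<bullet> y)"
    by (simp add: kconj_mult_self inner_vec_def)
  finally show "\<exists>r\<ge>0. (\<Sum>i\<in>UNIV. kconj (x $ i) * ((T ** adj T) *v x) $ i) = of_real r"
    by (auto simp: y_def matrix_vector_mul_assoc intro!: exI[of _ "y \<bullet> y"])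
qed

text \<open>\<open>pos_semidef\<close> speaks of a scalar-valued form, the assumption only of the
  real inner product. The gap is closed by a Hermitian square root \<open>T\<close>, an
  interpolating polynomial in \<open>S\<close>, which makes \<open>S\<close> a Gram matrix.\<close>

lemma pos_semidefI:
  fixes S :: "'k::euclidean_conj_algebra^'n^'n"
  assumes "hermitian S" and nonneg: "\<And>x. 0 \<le> x \<bullet> (S *v x)"
  shows "pos_semidef S"
proof -
  obtain p where p: "\<And>\<mu>. \<mu> \<in> eigenvals S \<Longrightarrow> poly p \<mu> = sqrt \<mu>"
    using poly_interpolation[OF finite_eigenvals[of S], of sqrt] by blast
  define T where "T = mpoly p S"
  have "T ** T = S"
  proof (rule hermitian_eqI[OF assms(1)])
    fix v \<mu> assume v: "v \<noteq> 0" "S *v v = \<mu> *\<^sub>R v"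
    then have "0 \<le> \<mu> * (v \<bullet> v)" "0 < v \<bullet> v"
      using nonneg[of v] by simp_all
    then have "0 \<le> \<mu>"
      using mult_neg_pos not_le by blast
    moreover have "T *v v = sqrt \<mu> *\<^sub>R v"
      using mpoly_eigenvector[OF v(2)] p v by (auto simp: T_def eigenvals_def)
    ultimately show "(T ** T) *v v = S *v v"
      by (simp add: v matrix_vector_mul_assoc[symmetric] matrix_vector_mult_scaleR_right)
  qed
  moreover have "adj T = T"
    using assms(1) by (simp add: T_def adj_mpoly hermitian_def)
  ultimately show ?thesis
    using pos_semidef_gram[of T] by simp
qed

text \<open>Writing the inverse root as the square of a polynomial \<open>Z\<close> in \<open>Y Y\<^sup>*\<close> exhibits \<open>Y \<Omega>\<^sup>*\<close> as the
  Gram matrix of \<open>Z Y\<close>, so its positivity is immediate.\<close>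

lemma polar_factor_of_injective:
  fixes Y :: "'k::euclidean_conj_algebra^'n^'n"
  assumes \<sigma>: "involutive_star_automorphism \<sigma>" "\<sigma> Y = adj Y"
    and inj: "\<And>x. adj Y *v x = 0 \<Longrightarrow> x = 0"
  obtains \<Omega> where "\<Omega> ** adj \<Omega> = mat 1" "\<sigma> \<Omega> = adj \<Omega>" "hermitian (Y ** adj \<Omega>)"
    "\<And>x. 0 \<le> x \<bullet> ((Y ** adj \<Omega>) *v x)"
proof -
  define P where "P = Y ** adj Y"
  have herm: "hermitian P"
    by (simp add: P_def hermitian_def adj_mult)
  \<comment> \<open>\<open>Z\<close> is to be the inverse fourth root of \<open>P\<close>, so that
    \<open>Z ** Z\<close> is the inverse square root. Injectivity of \<open>adj Y\<close> makes all
    eigenvalues of \<open>P\<close> positive, so no division by zero enters.\<close>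
  obtain p where p: "\<And>\<mu>. \<mu> \<in> eigenvals P \<Longrightarrow> poly p \<mu> = 1 / sqrt (sqrt \<mu>)"
    using poly_interpolation[OF finite_eigenvals[of P], of "\<lambda>\<mu>. 1 / sqrt (sqrt \<mu>)"] by blast
  define Z where "Z = mpoly p P"
  have adjZ: "adj Z = Z"
    using herm by (simp add: Z_def adj_mpoly hermitian_def)
  have ZP: "P ** Z = Z ** P"
    unfolding Z_def by (rule mpoly_intertwine[OF refl])
  have Z4: "Z ** (Z ** (Z ** (Z ** P))) = mat 1"
  proof (rule hermitian_eqI[OF herm])
    fix v \<mu> assume v: "v \<noteq> 0" "P *v v = \<mu> *\<^sub>R v"
    have "(P *v v) \<bullet> v = (adj Y *v v) \<bullet> (adj Y *v v)"
      unfolding P_def matrix_vector_mul_assoc[symmetric] by (rule inner_matrix_vector_adj)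
    moreover have "adj Y *v v \<noteq> 0"
      using inj v(1) by blast
    ultimately have "0 < \<mu> * (v \<bullet> v)"
      using v(2) by simp
    then have "0 < \<mu>"
      by (rule zero_less_mult_pos2) (simp add: v(1))
    moreover define r where "r = sqrt (sqrt \<mu>)"
    ultimately have "r \<noteq> 0" and \<mu>: "\<mu> = r * r * (r * r)"
      by simp_all
    have "Z *v v = (1 / r) *\<^sub>R v"
      using mpoly_eigenvector[OF v(2)] p v unfolding r_def by (auto simp: Z_def eigenvals_def)
    moreover have "P *v v = (r * r * (r * r)) *\<^sub>R v"
      using v(2) \<mu> by simp
    ultimately show "(Z ** (Z ** (Z ** (Z ** P)))) *v v = mat 1 *v v"
      using \<open>r \<noteq> 0\<close>
      by (simp add: matrix_vector_mul_assoc[symmetric] matrix_vector_mult_scaleR_right)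
  qed
  define \<Omega> where "\<Omega> = Z ** (Z ** Y)"
  have adj\<Omega>: "adj \<Omega> = adj Y ** (Z ** Z)"
    by (simp add: \<Omega>_def adj_mult adjZ matrix_mul_assoc)
  have PZZ: "P ** (Z ** Z) = Z ** (Z ** P)"
    by (metis (no_types) ZP matrix_mul_assoc[of P Z Z] matrix_mul_assoc[of Z P Z])
  have S: "Y ** adj \<Omega> = P ** (Z ** Z)"
    by (simp add: adj\<Omega> P_def matrix_mul_assoc)
  also have "\<dots> = (Z ** P) ** Z"
    by (simp only: matrix_mul_assoc ZP)
  also have "\<dots> = (Z ** Y) ** adj (Z ** Y)"
    by (simp only: adj_mult adjZ matrix_mul_assoc P_def)
  finally have gram: "Y ** adj \<Omega> = (Z ** Y) ** adj (Z ** Y)" .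
  show ?thesis
  proof
    have "\<Omega> ** adj \<Omega> = Z ** (Z ** (Y ** adj \<Omega>))"
      by (simp add: \<Omega>_def matrix_mul_assoc)
    then show "\<Omega> ** adj \<Omega> = mat 1"
      by (simp add: S PZZ Z4)
    show "hermitian (Y ** adj \<Omega>)"
      unfolding gram by (simp add: hermitian_def adj_mult)
    show "0 \<le> x \<bullet> ((Y ** adj \<Omega>) *v x)" for x
      unfolding gram by (rule gram_inner_nonneg)
    have auto: "algebra_automorphism \<sigma>" and mult: "\<And>A B. \<sigma> (A ** B) = \<sigma> A ** \<sigma> B"
      and "\<And>A. \<sigma> (adj A) = adj (\<sigma> A)"
      using \<sigma>(1) by (auto simp: involutive_star_automorphism_def algebra_automorphism_def)
    then have "\<sigma> Z = mpoly p (adj Y ** Y)"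
      by (simp add: Z_def algebra_automorphism_mpoly[OF auto] P_def \<sigma>(2))
    \<comment> \<open>\<sigma> exchanges \<open>Y ** adj Y\<close> and \<open>adj Y ** Y\<close>,
      and \<open>adj Y\<close> intertwines the two. Using this twice carries both factors
      \<open>\<sigma> Z\<close> across \<open>adj Y\<close>.\<close>
    then have \<sigma>Z: "\<sigma> Z ** adj Y = adj Y ** Z"
      unfolding Z_def using mpoly_intertwine[of "adj Y" P "adj Y ** Y" p]
      by (simp add: P_def matrix_mul_assoc)
    have "\<sigma> \<Omega> = \<sigma> Z ** (\<sigma> Z ** adj Y)"
      by (simp add: \<Omega>_def mult \<sigma>(2))
    also have "\<dots> = (\<sigma> Z ** adj Y) ** Z"
      by (simp only: \<sigma>Z matrix_mul_assoc)
    also have "\<dots> = adj \<Omega>"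
      by (simp only: \<sigma>Z adj\<Omega> matrix_mul_assoc)
    finally show "\<sigma> \<Omega> = adj \<Omega>" .
  qed
qed

text \<open>The diagonal entries of \<open>\<Omega> ** adj \<Omega>\<close> are the squared norms of
  the rows. The resulting bound on the orthogonal group supplies the compactness for the limit
  argument.\<close>

lemma norm_of_orthogonal:
  fixes \<Omega> :: "'k::euclidean_conj_algebra^'n^'n"
  assumes "\<Omega> ** adj \<Omega> = mat 1"
  shows "\<Omega> \<bullet> \<Omega> = real CARD('n)"
proof -
  have "(\<Omega> $ i) \<bullet> (\<Omega> $ i) = 1" for i
  proof -
    have "(of_real ((\<Omega> $ i) \<bullet> (\<Omega> $ i)) :: 'k) = (\<Sum>j\<in>UNIV. \<Omega> $ i $ j * kconj (\<Omega> $ i $ j))"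
      using kconj_mult_self[of "kconj (\<Omega> $ i $ j)" for j]
      by (simp add: inner_vec_def kconj_kconj inner_kconj_self)
    also have "\<dots> = (\<Omega> ** adj \<Omega>) $ i $ i"
      by (simp add: matrix_matrix_mult_def adj_def)
    finally show ?thesis
      by (simp add: assms mat_def)
  qed
  then show ?thesis
    by (simp add: inner_vec_def[of \<Omega>])
qed

section \<open>Passage to the limit along invertible perturbations of \<open>Y\<close>\<close>

lemma symmetric_polar_decomposition:
  fixes Y :: "'k::euclidean_conj_algebra^'n^'n"
  assumes \<sigma>: "involutive_star_automorphism \<sigma>" "\<sigma> Y = adj Y"
  shows "\<exists>S \<Omega>. polar_decomposition Y S \<Omega> \<and> \<sigma> \<Omega> = adj \<Omega> \<and> \<sigma> S = adj \<Omega> ** S ** \<Omega>"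
proof -
  have lin: "linear \<sigma>" and mult: "\<And>A B. \<sigma> (A ** B) = \<sigma> A ** \<sigma> B" and one: "\<sigma> (mat 1) = mat 1"
    and star: "\<And>A. \<sigma> (adj A) = adj (\<sigma> A)"
    using \<sigma>(1) by (auto simp: involutive_star_automorphism_def algebra_automorphism_def)
  \<comment> \<open>Nonzero real eigenvalues of \<open>adj Y\<close> have modulus at least
    \<open>d\<close>. For \<open>0 < t < d\<close> the number \<open>- t\<close> is thus no
    eigenvalue, and \<open>adj Y + t *\<^sub>R mat 1\<close> is injective.\<close>
  obtain d where d: "d > 0" "\<And>\<mu>. \<mu> \<in> eigenvals (adj Y) \<Longrightarrow> \<mu> \<noteq> 0 \<Longrightarrow> d \<le> dist 0 \<mu>"
    using finite_set_avoid[OF finite_eigenvals] by metis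
  \<comment> \<open>Halving \<open>d\<close> keeps the first term, at \<open>k = 0\<close>, strictly
    below \<open>d\<close>.\<close>
  define t where "t = (\<lambda>k. (d / 2) / real (Suc k))"
  have t: "0 < t k" "t k < d" for k
    using d(1) by (auto simp: t_def field_simps intro: add_pos_nonneg)
  have t0: "t \<longlonglongrightarrow> 0"
    unfolding t_def divide_inverse[of "d / 2"]
    by (rule tendsto_mult_right_zero[OF LIMSEQ_inverse_real_of_nat])
  define Yt where "Yt = (\<lambda>k. Y + t k *\<^sub>R mat 1)"
  have adjYt: "adj (Yt k) = adj Y + t k *\<^sub>R mat 1" for k
    by (simp add: Yt_def linear_add[OF linear_adj] linear_scale[OF linear_adj])
  have "\<exists>\<Omega>. \<Omega> ** adj \<Omega> = mat 1 \<and> \<sigma> \<Omega> = adj \<Omega> \<and> hermitian (Yt k ** adj \<Omega>) \<and>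
      (\<forall>x. 0 \<le> x \<bullet> ((Yt k ** adj \<Omega>) *v x))" for k
  proof (rule polar_factor_of_injective[OF \<sigma>(1), of "Yt k"])
    show "\<sigma> (Yt k) = adj (Yt k)"
      unfolding adjYt by (simp add: Yt_def linear_add[OF lin] linear_scale[OF lin] \<sigma>(2) one)
    show "x = 0" if "adj (Yt k) *v x = 0" for x
    proof (rule ccontr)
      assume "x \<noteq> 0"
      moreover have "adj Y *v x = (- t k) *\<^sub>R x"
        using that by (simp add: adjYt matrix_vector_mult_add_rdistrib scaleR_matrix_vector_mult
            eq_neg_iff_add_eq_0)
      ultimately have "- t k \<in> eigenvals (adj Y)"
        unfolding eigenvals_def by blast
      then show False
        using d(2)[of "- t k"] t[of k] by simp
    qed
  qed blast
  then obtain W where W: "\<And>k. W k ** adj (W k) = mat 1" "\<And>k. \<sigma> (W k) = adj (W k)"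
    "\<And>k. adj (Yt k ** adj (W k)) = Yt k ** adj (W k)"
    "\<And>k x. 0 \<le> x \<bullet> ((Yt k ** adj (W k)) *v x)"
    unfolding hermitian_def by metis
  \<comment> \<open>All factors lie in one closed ball, which is compact, so a subsequence
    converges.\<close>
  have "norm (W k) = sqrt (real CARD('n))" for k
    by (simp add: norm_eq_sqrt_inner norm_of_orthogonal[OF W(1)])
  then have "\<forall>k. W k \<in> cball 0 (sqrt (real CARD('n)))"
    by simp
  then obtain \<Omega> r where r: "strict_mono r" "(W \<circ> r) \<longlonglongrightarrow> \<Omega>"
    using compact_cball[of "0 :: 'k^'n^'n" "sqrt (real CARD('n))"] unfolding compact_def by metis
  have lim_lin: "(\<lambda>k. f (g k)) \<longlonglongrightarrow> f a"
    if "linear f" "g \<longlonglongrightarrow> a" for f :: "'k^'n^'n \<Rightarrow> 'k^'n^'n" and g a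
    using that bounded_linear.tendsto linear_conv_bounded_linear by blast
  note lim_mult = bounded_bilinear.tendsto[OF bounded_bilinear_matrix_mult]
  have Wr: "(\<lambda>k. W (r k)) \<longlonglongrightarrow> \<Omega>"
    using r(2) by (simp add: o_def)
  note adjWr = lim_lin[OF linear_adj Wr]
  have "(\<lambda>k. t (r k)) \<longlonglongrightarrow> 0"
    using LIMSEQ_subseq_LIMSEQ[OF t0 r(1)] by (simp add: o_def)
  then have "(\<lambda>k. Yt (r k)) \<longlonglongrightarrow> Y + 0 *\<^sub>R mat 1"
    unfolding Yt_def by (intro tendsto_intros)
  then have Yr: "(\<lambda>k. Yt (r k)) \<longlonglongrightarrow> Y"
    by simp
  define S where "S = Y ** adj \<Omega>"
  have Sr: "(\<lambda>k. Yt (r k) ** adj (W (r k))) \<longlonglongrightarrow> S"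
    unfolding S_def by (rule lim_mult[OF Yr adjWr])
  have orth: "\<Omega> ** adj \<Omega> = mat 1"
    using LIMSEQ_unique[OF lim_mult[OF Wr adjWr]] W(1) by simp
  have \<sigma>\<Omega>: "\<sigma> \<Omega> = adj \<Omega>"
    using LIMSEQ_unique[OF lim_lin[OF lin Wr]] adjWr W(2) by simp
  have adjS: "adj S = S"
    using LIMSEQ_unique[OF lim_lin[OF linear_adj Sr]] Sr W(3) by simp
  \<comment> \<open>For fixed \<open>x\<close> the expression is linear in the matrix, hence
    continuous, and the weak inequality survives the limit.\<close>
  have "0 \<le> x \<bullet> (S *v x)" for x
  proof -
    have "linear (\<lambda>A :: 'k^'n^'n. x \<bullet> (A *v x))"
      by (simp add: linear_iff matrix_vector_mult_add_rdistrib scaleR_matrix_vector_mult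
          inner_add_right)
    then have "(\<lambda>k. x \<bullet> ((Yt (r k) ** adj (W (r k))) *v x)) \<longlonglongrightarrow> x \<bullet> (S *v x)"
      using bounded_linear.tendsto[OF _ Sr] linear_conv_bounded_linear by blast
    then show ?thesis
      using W(4) by (intro LIMSEQ_le_const) auto
  qed
  then have psd: "pos_semidef S"
    using adjS by (intro pos_semidefI) (simp_all add: hermitian_def)
  \<comment> \<open>\<sigma> exchanges \<open>\<Omega>\<close> and its adjoint, so applying it to
    \<open>\<Omega> ** adj \<Omega> = mat 1\<close> yields the identity with the factors in the
    other order.\<close>
  have "\<sigma> (\<Omega> ** adj \<Omega>) = adj \<Omega> ** \<Omega>"
    by (simp add: mult star \<sigma>\<Omega>)
  then have orth': "adj \<Omega> ** \<Omega> = mat 1"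
    by (simp add: orth one)
  have Y: "Y = S ** \<Omega>"
    unfolding S_def matrix_mul_assoc[symmetric] orth' by simp
  have "adj Y = adj \<Omega> ** S"
    using arg_cong[OF Y, of adj] by (simp add: adj_mult adjS)
  \<comment> \<open>Here \<open>\<sigma> (adj \<Omega>) = \<Omega>\<close>, so
    \<open>\<sigma> S = adj Y ** \<Omega>\<close>.\<close>
  then have "\<sigma> S = adj \<Omega> ** S ** \<Omega>"
    by (simp add: S_def[THEN arg_cong, of \<sigma>] mult star \<sigma>\<Omega> \<sigma>(2))
  with Y orth psd \<sigma>\<Omega> show ?thesis
    unfolding polar_decomposition_def orthogonal_group_def by blast
qed

theorem theorem5p3:
  shows "(\<forall>(\<sigma> :: (real, 'n::{finite,linorder}) sq_matrix \<Rightarrow> (real, 'n) sq_matrix) Y D.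
        involutive_star_automorphism \<sigma> \<and> \<sigma> Y = adj Y \<and>
        singular_value_matrix Y D \<and> pos_semidef (\<sigma> D) \<longrightarrow>
        (\<exists>S \<Omega>. polar_decomposition Y S \<Omega> \<and>
           \<sigma> \<Omega> = adj \<Omega> \<and> \<sigma> S = adj \<Omega> ** S ** \<Omega>)) \<and>
     (\<forall>(\<sigma> :: (complex, 'n) sq_matrix \<Rightarrow> (complex, 'n) sq_matrix) Y D.
        involutive_star_automorphism \<sigma> \<and> \<sigma> Y = adj Y \<and>
        singular_value_matrix Y D \<and> pos_semidef (\<sigma> D) \<longrightarrow>
        (\<exists>S \<Omega>. polar_decomposition Y S \<Omega> \<and>
           \<sigma> \<Omega> = adj \<Omega> \<and> \<sigma> S = adj \<Omega> ** S ** \<Omega>)) \<and>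
     (\<forall>(\<sigma> :: (quat, 'n) sq_matrix \<Rightarrow> (quat, 'n) sq_matrix) Y D.
        involutive_star_automorphism \<sigma> \<and> \<sigma> Y = adj Y \<and>
        singular_value_matrix Y D \<and> pos_semidef (\<sigma> D) \<longrightarrow>
        (\<exists>S \<Omega>. polar_decomposition Y S \<Omega> \<and>
           \<sigma> \<Omega> = adj \<Omega> \<and> \<sigma> S = adj \<Omega> ** S ** \<Omega>))"
  \<comment> \<open>The real, complex and quaternionic scalars are instances of
    \<open>euclidean_conj_algebra\<close>, so one lemma settles all three cases.\<close>
  by (intro conjI allI impI; elim conjE; rule symmetric_polar_decomposition)

end
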